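(* Let $\mathcal{O}_K$ be the ring of integers of a number field $K$, and assume $\mathcal{O}_K$ has class number $1$. Let $\mathcal{O} \subseteq \mathcal{O}_K$ be an order whose conductor $\mathfrak{f} = \{\alpha \in \mathcal{O}_K \mid \alpha\mathcal{O}_K \subseteq \mathcal{O}\}$ is a prime ideal of $\mathcal{O}_K$. If $\bar{D}(\mathcal{O})$ is finite, then $\rho(\mathcal{O})$ is finite.
   Context: For an atomic domain $R$ and a non-empty subset $\mathcal{O}\subseteq R$: an $R$-product of length $n$ is a formal product (finite sequence, repetitions allowed) $\pi_1\pi_2\cdots\pi_n$ of irreducible elements $\pi_i\in \mathrm{Irr}(R)$; it is an $\mathcal{O}$-product if its value $\pi_1\pi_2\cdots\pi_n$ lies in $\mathcal{O}$. An $\mathcal{O}$-subproduct of an $R$-product is a non-empty subproduct (over a non-empty subset of the indices, possibly all of them) which is an $\mathcal{O}$-product. Define $D_{\mathcal{O}}(R) = \min\{n \mid \text{any } R\text{-product of length } n \text{ has an } \mathcal{O}\text{-subproduct}\}$, and $D_{\mathcal{O}}(R)=\infty$ if no such $n$ exists. If $\mathcal{O}$ is a domain and $R$ is its integral closure, write $\bar{D}(\mathcal{O}) = D_{\mathcal{O}}(R)$; for an order $\mathcal{O}\subseteq\mathcal{O}_K$ this is $D_{\mathcal{O}}(\mathcal{O}_K)$. The elasticity of an atomic domain $R$ is $\rho(R) = \sup\{ n/m \mid \alpha_1\cdots\alpha_n = \beta_1\cdots\beta_m,\ \alpha_i,\beta_j\in\mathrm{Irr}(R)\}$, possibly $\infty$.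 *)

theory Defs
  imports
    "HOL-Algebra.Algebra"
    "HOL-Algebra.Algebraic_Closure_Type"
    "HOL-Library.Extended_Nat"
    "HOL-Library.Extended_Nonnegative_Real"
begin

text \<open>
  Number fields and their subrings are subsets of an ambient field of characteristic zero, given as
  a type. Every number field is isomorphic to such a subset (of the complex numbers, say).
  The notions of \<^theory>\<open>HOL-Algebra.Algebra\<close> apply to a subset \<open>S\<close> through the following record.
\<close>

abbreviation ring_on :: "'a::field_char_0 set \<Rightarrow> 'a ring" where
  "ring_on S \<equiv> ring_of_type_algebra\<lparr>carrier := S\<rparr>"

abbreviation rat_span :: "'a::field_char_0 set \<Rightarrow> 'a set" where
  "rat_span \<equiv> Modules.module.span (\<lambda>(q::rat) x. of_rat q * x)"

abbreviation int_span :: "'a::field_char_0 set \<Rightarrow> 'a set" where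
  "int_span \<equiv> Modules.module.span (\<lambda>(k::int) x. of_int k * x)"

definition number_field :: "'a::field_char_0 set \<Rightarrow> bool" where
  "number_field K \<longleftrightarrow> subfield K (ring_on UNIV) \<and> (\<exists>B. finite B \<and> rat_span B = K)"

definition ring_of_integers :: "'a::field_char_0 set \<Rightarrow> 'a set" where
  "ring_of_integers K = {x \<in> K. algebraic_int x}"

text \<open>An order in \<open>K\<close> is a subring that is a full \<open>\<int>\<close>-lattice in \<open>K\<close>.\<close>

definition order_in :: "'a::field_char_0 set \<Rightarrow> 'a set \<Rightarrow> bool" where
  "order_in K \<O> \<longleftrightarrow> subring \<O> (ring_on K) \<and>
     (\<exists>B. finite B \<and> int_span B = \<O>) \<and> rat_span \<O> = K"

definition conductor :: "('a, 'b) ring_scheme \<Rightarrow> 'a set \<Rightarrow> 'a set" where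
  "conductor R \<O> = {\<alpha> \<in> carrier R. \<alpha> <#\<^bsub>R\<^esub> carrier R \<subseteq> \<O>}"

definition nonzero_ideals :: "('a, 'b) ring_scheme \<Rightarrow> 'a set set" where
  "nonzero_ideals R = {I. ideal I R \<and> I \<noteq> {\<zero>\<^bsub>R\<^esub>}}"

definition ideal_class_rel :: "('a, 'b) ring_scheme \<Rightarrow> ('a set \<times> 'a set) set" where
  "ideal_class_rel R = {(I, J). I \<in> nonzero_ideals R \<and> J \<in> nonzero_ideals R \<and>
     (\<exists>a\<in>carrier R - {\<zero>\<^bsub>R\<^esub>}. \<exists>b\<in>carrier R - {\<zero>\<^bsub>R\<^esub>}. a <#\<^bsub>R\<^esub> I = b <#\<^bsub>R\<^esub> J)}"

text \<open>
  Every fractional ideal is a multiple of an integral one, so the ideal class group of a Dedekind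
  domain consists of the classes of nonzero integral ideals. \<^const>\<open>card\<close> is \<open>0\<close> on infinite sets.
\<close>

definition class_number :: "('a, 'b) ring_scheme \<Rightarrow> nat" where
  "class_number R = card (nonzero_ideals R // ideal_class_rel R)"

definition Irr :: "('a, 'b) ring_scheme \<Rightarrow> 'a set" where
  "Irr R = {x \<in> carrier R. ring_irreducible\<^bsub>R\<^esub> x}"

text \<open>An \<open>R\<close>-product is a list over \<^term>\<open>Irr R\<close>; a subproduct is given by a set of positions.\<close>

definition has_subproduct_in :: "('a, 'b) ring_scheme \<Rightarrow> 'a set \<Rightarrow> 'a list \<Rightarrow> bool" where
  "has_subproduct_in R \<O> xs \<longleftrightarrow>
     (\<exists>I. I \<noteq> {} \<and> I \<subseteq> {..<length xs} \<and> (\<Otimes>\<^bsub>R\<^esub>i\<in>I. xs ! i) \<in> \<O>)"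

text \<open>In \<^typ>\<open>enat\<close>, the infimum of the empty set is \<open>\<infinity>\<close>, and any other infimum is a minimum.\<close>

definition rel_Davenport :: "('a, 'b) ring_scheme \<Rightarrow> 'a set \<Rightarrow> enat" where
  "rel_Davenport R \<O> =
     Inf {enat n |n. \<forall>xs. set xs \<subseteq> Irr R \<and> length xs = n \<longrightarrow> has_subproduct_in R \<O> xs}"

definition elasticity :: "('a, 'b) ring_scheme \<Rightarrow> ennreal" where
  "elasticity R = Sup {ennreal (real (length xs) / real (length ys)) |xs ys.
     set xs \<subseteq> Irr R \<and> set ys \<subseteq> Irr R \<and> xs \<noteq> [] \<and> ys \<noteq> [] \<and>
     (\<Otimes>\<^bsub>R\<^esub>i\<in>{..<length xs}. xs ! i) = (\<Otimes>\<^bsub>R\<^esub>i\<in>{..<length ys}. ys ! i)}"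

end

theory Submission
  imports Defs
begin

text \<open>
  Class number one makes \<open>\<O>\<^sub>K\<close> a principal ideal domain. If every product of \<open>n\<close> primes of \<open>\<O>\<^sub>K\<close>
  has an \<open>\<O>\<close>-subproduct, then every irreducible \<open>a\<close> of \<open>\<O>\<close> has at most \<open>n\<close> prime factors in \<open>\<O>\<^sub>K\<close>:
  among more of them, set one aside (one lying in the conductor \<open>F\<close> if \<open>a \<in> F\<close>) and split off an
  \<open>\<O>\<close>-subproduct \<open>b\<close> of the others. The cofactor \<open>a / b\<close> is again in \<open>\<O>\<close>, either because it lies in
  \<open>F\<close> or because \<open>b\<close> is invertible modulo \<open>F\<close> with an inverse in \<open>\<O>\<close>; so \<open>a\<close> was reducible.
  Comparing numbers of prime factors in \<open>\<O>\<^sub>K\<close>, the elasticity is at most \<open>n\<close>.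

  Invertibility modulo \<open>F\<close> needs \<open>F \<noteq> 0\<close>. This also follows from the subproduct property, without
  using that \<open>\<O>\<close> has full rank: every prime of \<open>\<O>\<^sub>K\<close> has a power with exponent at most \<open>n\<close> in \<open>\<O>\<close>, so
  \<open>(2 y) ^ n! \<in> \<O>\<close> for all \<open>y \<in> \<O>\<^sub>K\<close>, and iterated differences in \<open>y\<close> give an integer \<open>c \<noteq> 0\<close> with
  \<open>c \<O>\<^sub>K \<subseteq> \<O>\<close>.
\<close>

section \<open>Subrings given as subsets of a field\<close>

lemma ring_of_type_algebra_simps [simp]:
  "monoid.mult ring_of_type_algebra = (*)" "add ring_of_type_algebra = (+)"
  "\<one>\<^bsub>ring_of_type_algebra\<^esub> = 1" "\<zero>\<^bsub>ring_of_type_algebra\<^esub> = 0"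
  by (simp_all add: ring_of_type_algebra_def)

lemma ring_on_UNIV: "ring_on UNIV = ring_of_type_algebra"
  by (simp add: ring_of_type_algebra_def)

lemma domain_ring_on:
  assumes "cring (ring_on S)"
  shows "domain (ring_on S)"
  using assms by (auto intro!: domain.intro domain_axioms.intro)

lemma cring_ring_on_closed:
  assumes "cring (ring_on S)"
  shows "0 \<in> S" "1 \<in> S" "\<And>x y. x \<in> S \<Longrightarrow> y \<in> S \<Longrightarrow> x + y \<in> S"
    "\<And>x y. x \<in> S \<Longrightarrow> y \<in> S \<Longrightarrow> x * y \<in> S" "\<And>x y. x \<in> S \<Longrightarrow> y \<in> S \<Longrightarrow> x - y \<in> S"
proof -
  interpret cring "ring_on S" by fact
  show "0 \<in> S" "1 \<in> S" and add: "\<And>x y. x \<in> S \<Longrightarrow> y \<in> S \<Longrightarrow> x + y \<in> S"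
    and "\<And>x y. x \<in> S \<Longrightarrow> y \<in> S \<Longrightarrow> x * y \<in> S"
    using zero_closed one_closed a_closed m_closed by simp_all
  \<comment> \<open>The record has its own additive inverse; uniqueness of inverses in the ambient
    field identifies it with \<open>- y\<close>.\<close>
  have "- y \<in> S" if "y \<in> S" for y
  proof -
    from that have "\<ominus>\<^bsub>ring_on S\<^esub> y \<in> S" "y + \<ominus>\<^bsub>ring_on S\<^esub> y = 0"
      using a_inv_closed[of y] r_neg[of y] by simp_all
    then show ?thesis by (metis add_eq_0_iff)
  qed
  then show "\<And>x y. x \<in> S \<Longrightarrow> y \<in> S \<Longrightarrow> x - y \<in> S"
    using add by (metis diff_conv_add_uminus)
qed

lemma Units_ring_on: "Units (ring_on S) = {x \<in> S. \<exists>y\<in>S. x * y = 1}"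
  by (auto simp: Units_def mult.commute)

lemma finprod_ring_on:
  assumes "cring (ring_on S)" "finite A" "f ` A \<subseteq> S"
  shows "finprod (ring_on S) f A = prod f A"
proof -
  interpret cring "ring_on S" by fact
  from assms(2,3) show ?thesis
  proof (induction A rule: finite_induct)
    case (insert x F)
    then show ?case using finprod_insert[of F x f] by (auto simp: Pi_def image_subset_iff)
  qed simp
qed

lemma prod_in_ring_on:
  assumes "cring (ring_on S)" "f ` A \<subseteq> S"
  shows "prod f A \<in> S"
  using assms(2)
  by (induction A rule: infinite_finite_induct) (auto simp: cring_ring_on_closed[OF assms(1)])

lemma prod_list_in_ring_on:
  assumes "cring (ring_on S)" "set xs \<subseteq> S"
  shows "prod_list xs \<in> S"
  using assms(2) by (induction xs) (auto simp: cring_ring_on_closed[OF assms(1)])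

lemma power_in_ring_on:
  assumes "cring (ring_on S)" "x \<in> S"
  shows "x ^ n \<in> S"
  using assms(2) by (induction n) (auto simp: cring_ring_on_closed[OF assms(1)])

lemma Ints_subset_ring_on:
  assumes "cring (ring_on S)"
  shows "\<int> \<subseteq> S"
proof
  fix x :: 'a assume "x \<in> \<int>"
  then obtain k where x: "x = of_int k" by (auto elim: Ints_cases)
  have "of_int k \<in> S"
    by (induction k rule: int_induct[of _ 0]) (auto simp: cring_ring_on_closed[OF assms])
  with x show "x \<in> S" by simp
qed

lemma Irr_ring_on_iff:
  assumes "cring (ring_on S)"
  shows "x \<in> Irr (ring_on S) \<longleftrightarrow> x \<in> S \<and> x \<noteq> 0 \<and> x \<notin> Units (ring_on S) \<and>
    (\<forall>a\<in>S. \<forall>b\<in>S. x = a * b \<longrightarrow> a \<in> Units (ring_on S) \<or> b \<in> Units (ring_on S))"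
proof -
  interpret domain "ring_on S" by (rule domain_ring_on) fact
  show ?thesis
  proof
    assume "x \<in> Defs.Irr (ring_on S)"
    then have "x \<in> carrier (ring_on S)" "ring_irreducible\<^bsub>ring_on S\<^esub> x"
      by (simp_all add: Defs.Irr_def)
    from ring_irreducibleE[OF this] this(1) show "x \<in> S \<and> x \<noteq> 0 \<and> x \<notin> Units (ring_on S) \<and>
      (\<forall>a\<in>S. \<forall>b\<in>S. x = a * b \<longrightarrow> a \<in> Units (ring_on S) \<or> b \<in> Units (ring_on S))"
      by simp
  next
    assume "x \<in> S \<and> x \<noteq> 0 \<and> x \<notin> Units (ring_on S) \<and>
      (\<forall>a\<in>S. \<forall>b\<in>S. x = a * b \<longrightarrow> a \<in> Units (ring_on S) \<or> b \<in> Units (ring_on S))"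
    then show "x \<in> Defs.Irr (ring_on S)"
      using ring_irreducibleI[of x] by (simp add: Defs.Irr_def)
  qed
qed

lemma has_subproduct_in_ring_on_iff:
  assumes "cring (ring_on S)" "set xs \<subseteq> S"
  shows "has_subproduct_in (ring_on S) T xs \<longleftrightarrow>
    (\<exists>I. I \<noteq> {} \<and> I \<subseteq> {..<length xs} \<and> (\<Prod>i\<in>I. xs ! i) \<in> T)"
proof -
  have "finprod (ring_on S) ((!) xs) I = (\<Prod>i\<in>I. xs ! i)" if "I \<subseteq> {..<length xs}" for I
  proof (rule finprod_ring_on[OF assms(1)])
    show "finite I" using that by (rule finite_subset) simp
    show "(!) xs ` I \<subseteq> S" using that assms(2) by (auto dest!: subsetD intro: nth_mem)
  qed
  then show ?thesis unfolding has_subproduct_in_def by (intro ex_cong1) auto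
qed

text \<open>Each factor of a unit is itself a unit, so one irreducible factor, available because
  \<open>A\<close> is nonempty, already rules this out.\<close>

lemma prod_Irr_notin_Units:
  assumes "cring (ring_on S)" "finite A" "A \<noteq> {}" "f ` A \<subseteq> Irr (ring_on S)"
  shows "prod f A \<notin> Units (ring_on S)"
proof
  assume "prod f A \<in> Units (ring_on S)"
  then obtain y where y: "y \<in> S" "prod f A * y = 1" by (auto simp: Units_ring_on)
  from assms(3) obtain i where i: "i \<in> A" by auto
  have irr: "f j \<in> Irr (ring_on S)" if "j \<in> A" for j using that assms(4) by auto
  have S: "f j \<in> S" if "j \<in> A" for j
    using irr[OF that] by (simp add: Irr_ring_on_iff[OF assms(1)])
  have "f i * (prod f (A - {i}) * y) = 1"
    using y(2) prod.remove[OF assms(2) i, of f] by (simp add: mult.assoc)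
  moreover have "prod f (A - {i}) * y \<in> S"
    using y(1) S by (auto intro!: cring_ring_on_closed[OF assms(1)] prod_in_ring_on[OF assms(1)])
  ultimately have "f i \<in> Units (ring_on S)"
    using S[OF i] by (auto simp: Units_ring_on)
  with irr[OF i] show False by (simp add: Irr_ring_on_iff[OF assms(1)])
qed

section \<open>Class number one\<close>

lemma l_coset_ring_of_type_algebra: "a <#\<^bsub>ring_of_type_algebra\<^esub> T = (*) a ` T"
  by (auto simp: l_coset_def)

text \<open>The unit ideal and \<open>I\<close> share the only class, so \<open>a S = b I\<close>
  for some nonzero \<open>a\<close>, \<open>b\<close>. Writing \<open>a = b * c\<close> with
  \<open>c\<close> in \<open>I\<close> and cancelling \<open>b\<close> gives
  \<open>I = c S\<close>.\<close>

lemma principal_domain_of_class_number_one: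
  assumes "cring (ring_on S)" "class_number (ring_on S) = 1"
  shows "principal_domain (ring_on S)"
proof -
  let ?R = "ring_on S"
  interpret domain ?R by (rule domain_ring_on) fact
  have "\<exists>a\<in>carrier ?R. I = PIdl\<^bsub>?R\<^esub> a" if I: "ideal I ?R" for I
  proof (cases "I = {0}")
    case True
    then show ?thesis
      using cring_ring_on_closed(1)[OF assms(1)] by (intro bexI[of _ 0]) (auto simp: cgenideal_def)
  next
    case False
    then have nz: "I \<in> nonzero_ideals ?R" using I by (simp add: nonzero_ideals_def)
    have S: "S \<in> nonzero_ideals ?R"
      using oneideal one_not_zero one_closed by (auto simp: nonzero_ideals_def)
    \<comment> \<open>Once the images of \<open>S\<close> and \<open>I\<close> under the relation
      agree, reflexivity at \<open>I\<close> alone yields \<open>(S, I)\<close>; symmetry and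
      transitivity need not be established.\<close>
    have "(I, I) \<in> ideal_class_rel ?R"
      using nz cring_ring_on_closed(2)[OF assms(1)]
      by (auto simp: ideal_class_rel_def intro!: bexI[of _ 1])
    moreover obtain C where C: "nonzero_ideals ?R // ideal_class_rel ?R = {C}"
      using assms(2) by (auto simp: class_number_def card_1_singleton_iff)
    then have "ideal_class_rel ?R `` {S} = ideal_class_rel ?R `` {I}"
      using quotientI[OF S, of "ideal_class_rel ?R"] quotientI[OF nz, of "ideal_class_rel ?R"] by simp
    ultimately have "(S, I) \<in> ideal_class_rel ?R" by blast
    then obtain a b where ab: "a \<in> S" "a \<noteq> 0" "b \<in> S" "b \<noteq> 0" "(*) a ` S = (*) b ` I"
      by (auto simp: ideal_class_rel_def l_coset_ring_of_type_algebra)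
    have "a \<in> (*) a ` S"
      using cring_ring_on_closed(2)[OF assms(1)] by (rule rev_image_eqI) simp
    then obtain c where c: "c \<in> I" "a = b * c"
      unfolding ab(5) by blast
    have "(*) b ` I = (*) b ` ((*) c ` S)"
      using ab(5) by (simp add: c(2) image_image mult.assoc)
    moreover have "inj ((*) b)" using ab(4) by (simp add: inj_on_def)
    ultimately have "I = (*) c ` S" by (simp only: inj_image_eq_iff)
    moreover have "c \<in> S" using ideal.Icarr[OF I c(1)] by simp
    ultimately show ?thesis
      by (intro bexI[of _ c]) (auto simp: cgenideal_def mult.commute)
  qed
  then show ?thesis by unfold_locales
qed

lemma exists_Irr_factorization:
  assumes "principal_domain (ring_on S)" "x \<in> S" "x \<noteq> 0" "x \<notin> Units (ring_on S)"
  shows "\<exists>xs. xs \<noteq> [] \<and> set xs \<subseteq> Irr (ring_on S) \<and> prod_list xs = x"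
proof -
  interpret principal_domain "ring_on S" by fact
  obtain xs where xs: "set xs \<subseteq> carrier (Ring_Divisibility.mult_of (ring_on S))"
      "factors (Ring_Divisibility.mult_of (ring_on S)) xs x"
    using mult_of.factors_exist[of x] assms(2-4) by auto
  have "prod_list xs = x"
    using xs(2) by (simp add: factors_def prod_list.eq_foldr)
  moreover have "set xs \<subseteq> Defs.Irr (ring_on S)"
  proof
    fix y assume "y \<in> set xs"
    then have "y \<in> carrier (ring_on S) - {\<zero>\<^bsub>ring_on S\<^esub>}"
      "Divisibility.irreducible (Ring_Divisibility.mult_of (ring_on S)) y"
      using xs by (auto simp: factors_def)
    then show "y \<in> Defs.Irr (ring_on S)"
      using ring_irreducibleI'[of y] by (simp add: Defs.Irr_def)
  qed
  moreover have "xs \<noteq> []"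
    using calculation(1) assms(2,4) by (auto simp: Units_ring_on)
  ultimately show ?thesis by blast
qed

text \<open>In a factorial monoid \<open>factorcount\<close> depends only on the element, and it
  equals the length of every factorization.\<close>

lemma length_Irr_factorization_unique:
  assumes "principal_domain (ring_on S)" "set xs \<subseteq> Irr (ring_on S)" "set ys \<subseteq> Irr (ring_on S)"
    and "prod_list xs = prod_list ys"
  shows "length xs = length ys"
proof -
  interpret principal_domain "ring_on S" by fact
  let ?M = "Ring_Divisibility.mult_of (ring_on S)"
  have irr: "x \<in> carrier ?M" "Divisibility.irreducible ?M x" if "x \<in> Defs.Irr (ring_on S)" for x
    using that ring_irreducibleE(1,3)[of x] by (simp_all add: Defs.Irr_def)
  have wf: "wfactors ?M zs (prod_list zs)" "prod_list zs \<in> carrier ?M" "set zs \<subseteq> carrier ?M"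
    if "set zs \<subseteq> Defs.Irr (ring_on S)" for zs
  proof -
    from that irr(1) show sub: "set zs \<subseteq> carrier ?M" by blast
    have "\<forall>z\<in>set zs. Divisibility.irreducible ?M z" using that irr(2) by blast
    then have "factors ?M zs (prod_list zs)"
      by (simp add: factors_def prod_list.eq_foldr)
    then show "wfactors ?M zs (prod_list zs)" "prod_list zs \<in> carrier ?M"
      using mult_of.factors_wfactors mult_of.factors_closed sub by blast+
  qed
  show ?thesis
    using mult_of.factorcount_unique[OF wf[OF assms(2)]]
      mult_of.factorcount_unique[OF wf[OF assms(3)]] assms(4) by simp
qed

section \<open>Nonvanishing of the conductor\<close>

lemma conductor_ring_on: "conductor (ring_on S) T = {a \<in> S. \<forall>h\<in>S. a * h \<in> T}"
  by (auto simp: conductor_def l_coset_ring_of_type_algebra)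

lemma Ints_coeff_pcompose_shift:
  fixes p :: "'a::comm_ring_1 poly"
  assumes "\<forall>i. coeff p i \<in> \<int>"
  shows "\<forall>i. coeff (pcompose p [:1, 1:]) i \<in> \<int>"
  using assms
proof (induction p)
  case (pCons a p)
  have "coeff p i \<in> \<int>" for i using spec[OF pCons.prems, of "Suc i"] by simp
  moreover have "a \<in> \<int>" using spec[OF pCons.prems, of 0] by simp
  ultimately show ?case
    using pCons.IH by (auto simp: pcompose_pCons coeff_pCons split: nat.split)
qed simp

text \<open>The leading terms cancel, so the degree drops. Were the difference a constant
  \<open>c\<close>, then \<open>p\<close> would agree with a polynomial of degree at most one at all
  natural numbers, which are infinitely many in characteristic zero.\<close>

lemma degree_shift_diff:
  fixes p :: "'a::field_char_0 poly"
  assumes "degree p > 1"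
  defines "q \<equiv> pcompose p [:1, 1:] - p"
  shows "0 < degree q" "degree q < degree p"
proof -
  have "coeff (pcompose p [:1, 1:]) (degree p) = lead_coeff p"
    using lead_coeff_comp[of "[:1, 1:]" p] by (simp add: degree_pcompose)
  then have "coeff q (degree p) = 0" by (simp add: q_def)
  moreover have "degree q \<le> degree p"
    unfolding q_def by (intro degree_diff_le) (auto simp: degree_pcompose)
  ultimately show "degree q < degree p"
    using assms(1) by (metis degree_0 leading_coeff_0_iff le_neq_implies_less less_nat_zero_code not_less_iff_gr_or_eq)
  show "0 < degree q"
  proof (rule ccontr)
    assume "\<not> 0 < degree q"
    then obtain c where q: "q = [:c:]" by (metis degree_eq_zeroE gr0I)
    have step: "poly p (1 + x) = poly p x + c" for x
    proof -
      have "poly q x = c" by (simp add: q)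
      then show ?thesis by (simp add: q_def poly_pcompose algebra_simps)
    qed
    have "poly p (of_nat k) = poly p 0 + of_nat k * c" for k
      by (induction k) (auto simp: step algebra_simps)
    then have "range of_nat \<subseteq> {x. poly (p - [:poly p 0, c:]) x = 0}" by auto
    moreover have "infinite (range (of_nat :: nat \<Rightarrow> 'a))"
      by (rule range_inj_infinite) (simp add: inj_on_def)
    ultimately have "infinite {x. poly (p - [:poly p 0, c:]) x = 0}"
      by (rule infinite_super)
    then have "p - [:poly p 0, c:] = 0" by (metis poly_roots_finite)
    then have "p = [:poly p 0, c:]" by simp
    moreover have "degree [:poly p 0, c:] \<le> 1" by simp
    ultimately have "degree p \<le> 1" by metis
    with assms(1) show False by simp
  qed
qed

text \<open>Repeated differences \<open>p(y + 1) - p(y)\<close> lower the degree of \<open>p\<close> to one.\<close>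

lemma Ints_multiple_of_poly_values:
  fixes p :: "'a::field_char_0 poly"
  assumes S: "cring (ring_on S)" and T: "cring (ring_on T)"
    and "\<forall>i. coeff p i \<in> \<int>" "degree p > 0" "\<forall>y\<in>S. poly p y \<in> T"
  shows "\<exists>c\<in>\<int>. c \<noteq> 0 \<and> (\<forall>y\<in>S. c * y \<in> T)"
  using assms(3-)
proof (induction "degree p" arbitrary: p rule: less_induct)
  case less
  show ?case
  proof (cases "degree p = 1")
    case True
    then obtain b q where "p = pCons b q" "degree q = 0" "q \<noteq> 0"
      by (cases p) (auto split: if_splits)
    then obtain c where p: "p = [:b, c:]" "c \<noteq> 0" by (auto elim: degree_eq_zeroE)
    have bc: "b \<in> \<int>" "c \<in> \<int>"
      using spec[OF less.prems(1), of 0] spec[OF less.prems(1), of 1] by (simp_all add: p(1))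
    have "c * y \<in> T" if "y \<in> S" for y
    proof -
      have "poly p y \<in> T" "b \<in> T"
        using that less.prems(3) bc(1) Ints_subset_ring_on[OF T] by auto
      then have "poly p y - b \<in> T" by (rule cring_ring_on_closed(5)[OF T])
      then show ?thesis by (simp add: p(1) mult.commute)
    qed
    with bc p(2) show ?thesis by blast
  next
    case False
    with less.prems(2) have deg: "degree p > 1" by simp
    let ?q = "pcompose p [:1, 1:] - p"
    show ?thesis
    proof (rule less.hyps[of ?q])
      show "degree ?q < degree p" "0 < degree ?q" using degree_shift_diff[OF deg] by auto
      show "\<forall>i. coeff ?q i \<in> \<int>"
        using Ints_coeff_pcompose_shift[OF less.prems(1)] less.prems(1) by simp
      show "\<forall>y\<in>S. poly ?q y \<in> T"
        using less.prems(3)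
        by (auto simp: poly_pcompose intro!: cring_ring_on_closed(5)[OF T] cring_ring_on_closed(2,3)[OF S])
    qed
  qed
qed

text \<open>A subproduct of \<open>n\<close> copies of \<open>x\<close> is a power of
  \<open>x\<close> with exponent between 1 and \<open>n\<close>. This exponent divides
  \<open>fact n\<close>, which makes the final exponent independent of \<open>x\<close>.\<close>

lemma has_subproduct_in_imp_power_fact_Irr:
  assumes S: "cring (ring_on S)" and T: "cring (ring_on T)"
    and D: "\<And>xs. set xs \<subseteq> Irr (ring_on S) \<Longrightarrow> length xs = n \<Longrightarrow> has_subproduct_in (ring_on S) T xs"
    and x: "x \<in> Irr (ring_on S)"
  shows "x ^ fact n \<in> T"
proof -
  have "x \<in> S" using x by (simp add: Irr_ring_on_iff[OF S])
  then have "set (replicate n x) \<subseteq> S" by auto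
  moreover have "has_subproduct_in (ring_on S) T (replicate n x)" using x by (intro D) auto
  ultimately obtain I where I: "I \<noteq> {}" "I \<subseteq> {..<n}" "(\<Prod>i\<in>I. replicate n x ! i) \<in> T"
    by (auto simp: has_subproduct_in_ring_on_iff[OF S])
  have "(\<Prod>i\<in>I. replicate n x ! i) = (\<Prod>i\<in>I. x)" using I(2) by (intro prod.cong) auto
  with I(3) have "x ^ card I \<in> T" by simp
  moreover have "finite I" using I(2) by (rule finite_subset) simp
  then have "0 < card I" "card I \<le> n"
    using I(1) card_mono[OF _ I(2)] by (auto simp: card_gt_0_iff)
  then have "card I dvd fact n" by (intro dvd_fact) auto
  then obtain k where "fact n = card I * k" by (auto elim: dvdE)
  ultimately show ?thesis
    by (simp add: power_mult power_in_ring_on[OF T])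
qed

text \<open>The factor 2 circumvents the units of \<open>S\<close>, which have no factorization into
  irreducibles: since \<open>1 / 2\<close> is not an algebraic integer, \<open>2 * y\<close> is
  never a unit.\<close>

lemma conductor_ne_zero:
  fixes S T :: "'a::field_char_0 set"
  assumes P: "principal_domain (ring_on S)" and T: "cring (ring_on T)"
    and int: "\<And>x. x \<in> S \<Longrightarrow> algebraic_int x"
    and D: "\<And>xs. set xs \<subseteq> Irr (ring_on S) \<Longrightarrow> length xs = n \<Longrightarrow> has_subproduct_in (ring_on S) T xs"
  shows "conductor (ring_on S) T \<noteq> {0}"
proof -
  have S: "cring (ring_on S)" using P by (simp add: principal_domain_def domain_def)
  let ?N = "fact n :: nat"
  have pow: "(2 * y) ^ ?N \<in> T" if y: "y \<in> S" for y
  proof (cases "y = 0")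
    case True
    then show ?thesis using cring_ring_on_closed(1)[OF T] by (simp add: zero_power)
  next
    case False
    have two: "2 * y \<in> S"
      using y cring_ring_on_closed(3)[OF S, of y y] by simp
    have "2 * y \<notin> Units (ring_on S)"
    proof
      assume "2 * y \<in> Units (ring_on S)"
      then obtain z where z: "z \<in> S" "2 * y * z = 1" by (auto simp: Units_ring_on)
      then have "y * z = 1 / 2" by (simp add: field_simps)
      then have "algebraic_int (1 / 2 :: 'a)"
        using int cring_ring_on_closed(4)[OF S y z(1)] by metis
      then have "(1 / 2 :: 'a) \<in> \<int>" by (rule rational_algebraic_int_is_int) auto
      then obtain k where "1 / 2 = (of_int k :: 'a)" by (auto elim: Ints_cases)
      then have "of_int (2 * k) = (of_int 1 :: 'a)" by (simp add: field_simps)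
      then have "2 * k = 1" by (simp only: of_int_eq_iff)
      then show False by presburger
    qed
    with two False obtain xs where xs: "set xs \<subseteq> Irr (ring_on S)" "prod_list xs = 2 * y"
      using exists_Irr_factorization[OF P, of "2 * y"] by auto
    have "prod_list xs ^ ?N \<in> T"
      using xs(1)
    proof (induction xs)
      case Nil
      then show ?case by (simp add: cring_ring_on_closed[OF T])
    next
      case (Cons x xs)
      then have "x ^ ?N \<in> T" using has_subproduct_in_imp_power_fact_Irr[OF S T D] by auto
      with Cons show ?case by (simp add: power_mult_distrib cring_ring_on_closed(4)[OF T])
    qed
    then show ?thesis using xs(2) by simp
  qed
  have "\<exists>c\<in>\<int>. c \<noteq> 0 \<and> (\<forall>y\<in>S. c * y \<in> T)"
  proof (rule Ints_multiple_of_poly_values[OF S T])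
    \<comment> \<open>This is \<open>(2 * y) ^ ?N\<close> as a polynomial in \<open>y\<close>; its
      degree is positive because a factorial is.\<close>
    let ?p = "monom (2 ^ ?N) ?N :: 'a poly"
    show "\<forall>i. coeff ?p i \<in> \<int>" by auto
    show "degree ?p > 0" by (simp add: degree_monom_eq)
    show "\<forall>y\<in>S. poly ?p y \<in> T" using pow by (simp add: poly_monom power_mult_distrib)
  qed
  then obtain c where "c \<in> \<int>" "c \<noteq> 0" "\<forall>y\<in>S. c * y \<in> T" by blast
  then have "c \<in> conductor (ring_on S) T"
    using Ints_subset_ring_on[OF S] by (auto simp: conductor_ring_on)
  with \<open>c \<noteq> 0\<close> show ?thesis by auto
qed

section \<open>Inverses modulo the conductor\<close>

lemma zero_mem_ideal_ring_on:
  assumes "ideal F (ring_on S)"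
  shows "0 \<in> F"
  using additive_subgroup.zero_closed[OF ideal.axioms(1)[OF assms]] by simp

text \<open>A nonzero prime ideal of a principal ideal domain is maximal, so \<open>b\<close> and
  \<open>F\<close> together generate the unit ideal; an expression of 1 gives
  \<open>d\<close>.\<close>

lemma prime_ideal_inverse:
  assumes P: "principal_domain (ring_on S)" and F: "primeideal F (ring_on S)" "F \<noteq> {0}"
    and b: "b \<in> S" "b \<notin> F"
  shows "\<exists>d\<in>S. b * d - 1 \<in> F"
proof -
  interpret principal_domain "ring_on S" by fact
  interpret F: primeideal F "ring_on S" by fact
  have S: "cring (ring_on S)" by (rule is_cring)
  obtain p where p: "p \<in> S" "F = PIdl\<^bsub>ring_on S\<^esub> p"
    using exists_gen[OF F.is_ideal] by auto
  have "p \<noteq> 0"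
  proof
    assume "p = 0"
    with p(2) have "F = {x * 0 |x. x \<in> S}" by (simp add: cgenideal_def)
    moreover have "{x * 0 |x. x \<in> S} = {0}" using p(1) by auto
    ultimately show False using F(2) by simp
  qed
  then have "ring_prime\<^bsub>ring_on S\<^esub> p"
    using primeideal_iff_prime[of p] p F(1) by simp
  then have max: "maximalideal F (ring_on S)"
    using primeness_condition[of p] irreducible_imp_maximalideal[of p] p by simp
  let ?J = "PIdl\<^bsub>ring_on S\<^esub> b <+>\<^bsub>ring_on S\<^esub> F"
  have J: "ideal ?J (ring_on S)"
    using b(1) by (intro add_ideals cgenideal_ideal F.is_ideal) simp
  have mem: "x \<in> ?J \<longleftrightarrow> (\<exists>d\<in>S. \<exists>f\<in>F. x = d * b + f)" for x
    by (auto simp: set_add_def' cgenideal_def)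
  have "F \<subseteq> ?J"
  proof
    fix f assume "f \<in> F"
    then show "f \<in> ?J"
      unfolding mem using cring_ring_on_closed(1)[OF S] by (intro bexI[of _ 0] bexI[of _ f]) auto
  qed
  moreover have "?J \<subseteq> carrier (ring_on S)" using ideal.Icarr[OF J] by auto
  moreover have "b \<in> ?J"
    unfolding mem using cring_ring_on_closed(2)[OF S] zero_mem_ideal_ring_on[OF F.is_ideal]
    by (intro bexI[of _ 1] bexI[of _ 0]) simp_all
  ultimately have "?J = S"
    using maximalideal.I_maximal[OF max J] b(2) by auto
  then obtain d f where df: "d \<in> S" "f \<in> F" "1 = d * b + f"
    using cring_ring_on_closed(2)[OF S] mem[of 1] by auto
  have "- 1 * f \<in> F"
    using F.I_l_closed[of f "- 1"] df(2) subsetD[OF Ints_subset_ring_on[OF S], of "- 1"] by simp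
  moreover have "b * d - 1 = - 1 * f" using df(3) by (simp add: algebra_simps)
  ultimately show ?thesis using df(1) by metis
qed

text \<open>
  Multiplying a monic equation of degree \<open>m + 1\<close> for \<open>d\<close> by \<open>b\<^sup>m\<close> and using \<open>b d \<equiv> 1\<close> expresses
  \<open>d\<close> modulo \<open>F\<close> as an integral polynomial in \<open>b\<close>.
\<close>

lemma integral_inverse_mod_ideal:
  assumes S: "cring (ring_on S)" and T: "cring (ring_on T)" "T \<subseteq> S"
    and F: "ideal F (ring_on S)" "F \<subseteq> T"
    and b: "b \<in> T" and d: "d \<in> S" "algebraic_int d" and bd: "b * d - 1 \<in> F"
  shows "d \<in> T"
proof -
  interpret F: ideal F "ring_on S" by fact
  note clS = cring_ring_on_closed[OF S] and clT = cring_ring_on_closed[OF T(1)]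
  have FS: "x * f \<in> F" if "x \<in> S" "f \<in> F" for x f
    using F.I_l_closed[of f x] that by simp
  have Fadd: "f + g \<in> F" if "f \<in> F" "g \<in> F" for f g
    using additive_subgroup.a_closed[OF ideal.axioms(1)[OF F(1)] that] by simp
  have bdS: "b * d \<in> S" using b T(2) d(1) clS(4) by blast
  have pow: "(b * d) ^ i - 1 \<in> F" for i
  proof (induction i)
    case 0
    then show ?case using zero_mem_ideal_ring_on[OF F.is_ideal] by simp
  next
    case (Suc i)
    have "(b * d) ^ Suc i - 1 = b * d * ((b * d) ^ i - 1) + (b * d - 1)"
      by (simp add: algebra_simps)
    with Suc show ?case using Fadd FS bdS bd by metis
  qed
  obtain p where p: "lead_coeff p = 1" "\<forall>i. coeff p i \<in> \<int>" "poly p d = 0"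
    using d(2) by (auto elim: algebraic_int.cases)
  have "degree p \<noteq> 0"
  proof
    assume "degree p = 0"
    then obtain c where "p = [:c:]" by (rule degree_eq_zeroE)
    with p(1,3) show False by simp
  qed
  then obtain m where m: "degree p = Suc m" by (metis not0_implies_Suc)
  let ?t = "\<Sum>i\<le>m. coeff p i * (d ^ i * b ^ m)"
  have sum_T: "(\<Sum>i\<in>A. f i) \<in> T" if "\<And>i. i \<in> A \<Longrightarrow> f i \<in> T" for f and A :: "nat set"
    using that by (induction A rule: infinite_finite_induct) (auto simp: clT)
  have "?t \<in> T"
  proof (rule sum_T)
    fix i assume "i \<in> {..m}"
    \<comment> \<open>As \<open>i \<le> m\<close>, every \<open>d\<close> can be paired with a
      \<open>b\<close>, so the term is congruent to \<open>b ^ (m - i)\<close> modulo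
      \<open>F\<close>.\<close>
    then have "b ^ m = b ^ i * b ^ (m - i)" by (simp flip: power_add)
    then have "d ^ i * b ^ m = b ^ (m - i) + b ^ (m - i) * ((b * d) ^ i - 1)"
      by (simp add: algebra_simps power_mult_distrib)
    moreover have bT: "b ^ (m - i) \<in> T" by (rule power_in_ring_on[OF T(1) b])
    moreover have "b ^ (m - i) * ((b * d) ^ i - 1) \<in> T" using FS pow bT T(2) F(2) by blast
    ultimately have "d ^ i * b ^ m \<in> T" using clT(3) by metis
    moreover have "coeff p i \<in> T" using p(2) Ints_subset_ring_on[OF T(1)] by auto
    ultimately show "coeff p i * (d ^ i * b ^ m) \<in> T" by (simp only: clT(4))
  qed
  moreover have "d * ((b * d) ^ m - 1) \<in> T" using FS d(1) pow F(2) by blast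
  \<comment> \<open>The monic top term becomes \<open>d * (b * d) ^ m\<close>, congruent to
    \<open>d\<close> modulo \<open>F\<close>; the equation is solved for \<open>d\<close>.\<close>
  moreover have "d = 0 - ?t - d * ((b * d) ^ m - 1)"
  proof -
    have "0 = poly p d * b ^ m" using p(3) by simp
    also have "\<dots> = ?t + d ^ Suc m * b ^ m"
      using p(1) by (simp add: poly_altdef m distrib_right sum_distrib_right mult.assoc)
    also have "d ^ Suc m * b ^ m = d * (b * d) ^ m"
      by (simp add: power_mult_distrib algebra_simps)
    finally show ?thesis by (simp add: algebra_simps)
  qed
  ultimately show ?thesis using clT(1,5) by metis
qed

section \<open>Factorization lengths\<close>

lemma primeideal_prod_list_mem:
  assumes S: "cring (ring_on S)" and F: "primeideal F (ring_on S)"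
    and "set xs \<subseteq> S" "prod_list xs \<in> F"
  shows "\<exists>x\<in>set xs. x \<in> F"
  using assms(3,4)
proof (induction xs)
  case Nil
  interpret F: primeideal F "ring_on S" by fact
  from Nil show ?case using F.one_imp_carrier F.I_notcarr by simp
next
  case (Cons x xs)
  then show ?case
    using primeideal.I_prime[OF F, of x "prod_list xs"] prod_list_in_ring_on[OF S, of xs] by auto
qed

text \<open>Here \<open>F\<close> may be any nonzero prime ideal of \<open>S\<close> inside
  \<open>T\<close>; the conductor is the intended instance.\<close>

lemma Irr_subring_factorization:
  assumes P: "principal_domain (ring_on S)" and T: "cring (ring_on T)" "T \<subseteq> S"
    and int: "\<And>x. x \<in> S \<Longrightarrow> algebraic_int x"
    and F: "primeideal F (ring_on S)" "F \<noteq> {0}" "F \<subseteq> T"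
    and D: "\<And>xs. set xs \<subseteq> Irr (ring_on S) \<Longrightarrow> length xs = n \<Longrightarrow> has_subproduct_in (ring_on S) T xs"
    and a: "a \<in> Irr (ring_on T)"
  shows "\<exists>xs. xs \<noteq> [] \<and> length xs \<le> n \<and> set xs \<subseteq> Irr (ring_on S) \<and> prod_list xs = a"
proof -
  have S: "cring (ring_on S)" using P by (simp add: principal_domain_def domain_def)
  note clS = cring_ring_on_closed[OF S] and clT = cring_ring_on_closed[OF T(1)]
  interpret F: primeideal F "ring_on S" by fact
  have F0: "0 \<in> F" using zero_mem_ideal_ring_on[OF F.is_ideal] by simp
  have FS: "f * x \<in> F" if "x \<in> S" "f \<in> F" for x f
    using F.I_r_closed[of f x] that by simp
  have inv_T: "d \<in> T" if "b \<in> T" "d \<in> S" "b * d - 1 \<in> F" for b d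
    using integral_inverse_mod_ideal[OF S T F.is_ideal F(3) that(1,2) int that(3)] that(2) .
  have units: "x \<in> Units (ring_on S)" if "x \<in> Units (ring_on T)" for x
    using that T(2) by (auto simp: Units_ring_on)
  have a': "a \<in> T" "a \<noteq> 0" "a \<notin> Units (ring_on T)"
    and irr: "\<And>b c. b \<in> T \<Longrightarrow> c \<in> T \<Longrightarrow> a = b * c \<Longrightarrow>
      b \<in> Units (ring_on T) \<or> c \<in> Units (ring_on T)"
    using a by (auto simp: Irr_ring_on_iff[OF T(1)])
  \<comment> \<open>An inverse in \<open>S\<close> is also an inverse modulo \<open>F\<close>, since
    0 lies in \<open>F\<close>, so \<open>inv_T\<close> would place it in \<open>T\<close>.\<close>
  have "a \<notin> Units (ring_on S)"
    using a'(1,3) inv_T[OF a'(1)] F0 by (auto simp: Units_ring_on)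
  then obtain xs where xs: "xs \<noteq> []" "set xs \<subseteq> Irr (ring_on S)" "prod_list xs = a"
    using exists_Irr_factorization[OF P, of a] a'(1,2) T(2) by auto
  have IrrS: "x \<in> S" if "x \<in> Irr (ring_on S)" for x
    using that by (simp add: Irr_ring_on_iff[OF S])
  have "length xs \<le> n"
  proof (rule ccontr)
    assume long: "\<not> length xs \<le> n"
    \<comment> \<open>The prime factor \<open>x\<close> set aside guarantees that the cofactor of the subproduct in \<open>T\<close>
      is nontrivial and, if \<open>a\<close> lies in \<open>F\<close>, that this cofactor lies in \<open>F\<close> as well.\<close>
    obtain x where x: "x \<in> set xs" "a \<in> F \<longrightarrow> x \<in> F"
      using primeideal_prod_list_mem[OF S F(1), of xs] xs IrrS
      by (metis hd_in_set subset_iff)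
    obtain us vs where uv: "xs = us @ x # vs" using x(1) by (auto dest: split_list)
    define ys where "ys = us @ vs"
    have ys: "set ys \<subseteq> Irr (ring_on S)" "n \<le> length ys" "a = x * prod_list ys"
      using xs(2,3) long by (auto simp: uv ys_def algebra_simps)
    \<comment> \<open>The hypothesis on subproducts concerns length exactly \<open>n\<close>, hence
      the truncation; its positions remain positions of \<open>ys\<close>.\<close>
    have "set (take n ys) \<subseteq> Irr (ring_on S)" using ys(1) set_take_subset by fast
    moreover from this have "set (take n ys) \<subseteq> S" using IrrS by blast
    ultimately obtain I where I: "I \<noteq> {}" "I \<subseteq> {..<n}" "(\<Prod>i\<in>I. take n ys ! i) \<in> T"
      using D[of "take n ys"] ys(2) by (auto simp: has_subproduct_in_ring_on_iff[OF S])
    define b c where "b = (\<Prod>i\<in>I. ys ! i)" and "c = x * (\<Prod>i\<in>{..<length ys} - I. ys ! i)"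
    have ysI: "ys ! i \<in> Irr (ring_on S)" if "i < length ys" for i
      using ys(1) that by auto
    have In: "I \<subseteq> {..<length ys}" "finite I"
      using I(2) ys(2) by (auto intro: finite_subset)
    have bT: "b \<in> T"
    proof -
      have "(\<Prod>i\<in>I. take n ys ! i) = b" unfolding b_def using I(2) by (intro prod.cong) auto
      with I(3) show ?thesis by simp
    qed
    have xS: "x \<in> S" using x(1) xs(2) IrrS by blast
    have rest: "(\<Prod>i\<in>{..<length ys} - I. ys ! i) \<in> S"
      using ysI IrrS by (intro prod_in_ring_on[OF S]) auto
    have cS: "c \<in> S" unfolding c_def by (rule clS(4)[OF xS rest])
    have abc: "a = b * c"
    proof -
      have "prod_list ys = (\<Prod>i<length ys. ys ! i)"
        by (simp add: prod.list_conv_set_nth atLeast0LessThan)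
      also have "\<dots> = b * (\<Prod>i\<in>{..<length ys} - I. ys ! i)"
        unfolding b_def using prod.subset_diff[OF In(1)] by (simp add: mult.commute)
      finally show ?thesis by (simp add: ys(3) c_def algebra_simps)
    qed
    \<comment> \<open>Units of \<open>T\<close> are units of \<open>S\<close>, so to contradict
      irreducibility it suffices that \<open>b\<close> and \<open>c\<close> are nonunits of
      \<open>S\<close>.\<close>
    have b_unit: "b \<notin> Units (ring_on S)"
      unfolding b_def using I(1) In ysI by (intro prod_Irr_notin_Units[OF S]) auto
    have c_unit: "c \<notin> Units (ring_on S)"
    proof
      assume "c \<in> Units (ring_on S)"
      then obtain z where "z \<in> S" "c * z = 1" by (auto simp: Units_ring_on)
      then have "x \<in> Units (ring_on S)"
        using xS clS(4)[OF rest] by (auto simp: Units_ring_on c_def mult.assoc)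
      then show False using x(1) xs(2) by (auto simp: Irr_ring_on_iff[OF S])
    qed
    have "c \<in> T"
    proof (cases "a \<in> F")
      case True
      then show ?thesis using x(2) FS[OF rest] F(3) by (auto simp: c_def)
    next
      case False
      then have "b \<notin> F" using FS[OF cS] abc by auto
      then obtain d where d: "d \<in> S" "b * d - 1 \<in> F"
        using prime_ideal_inverse[OF P F(1,2), of b] bT T(2) by auto
      \<comment> \<open>Modulo \<open>F\<close>, dividing \<open>a\<close> by \<open>b\<close>
        amounts to multiplying by \<open>d\<close>, which lies in \<open>T\<close>; the error term
        lies in \<open>F\<close>.\<close>
      have "c = a * d - (b * d - 1) * c" by (simp add: abc algebra_simps)
      moreover have "a * d \<in> T" using a'(1) inv_T[OF bT d] by (rule clT(4))
      moreover have "(b * d - 1) * c \<in> T" using FS[OF cS d(2)] F(3) by blast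
      ultimately show ?thesis using clT(5) by metis
    qed
    with irr[OF bT _ abc] units b_unit c_unit show False by blast
  qed
  with xs show ?thesis by blast
qed

text \<open>Each entry is replaced by a block of between 1 and \<open>n\<close> factors. The
  intended case has irreducibles of the subring as \<open>A\<close> and those of the larger ring as
  \<open>B\<close>.\<close>

lemma prod_list_refinement:
  assumes "\<And>x. x \<in> A \<Longrightarrow> \<exists>zs. zs \<noteq> [] \<and> length zs \<le> n \<and> set zs \<subseteq> B \<and> prod_list zs = x"
    and "set xs \<subseteq> A"
  shows "\<exists>zs. set zs \<subseteq> B \<and> prod_list zs = prod_list xs \<and>
    length xs \<le> length zs \<and> length zs \<le> n * length xs"
  using assms(2)
proof (induction xs)
  case (Cons x xs)
  then obtain zs where zs: "set zs \<subseteq> B" "prod_list zs = prod_list xs"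
    "length xs \<le> length zs" "length zs \<le> n * length xs" by auto
  obtain us where us: "us \<noteq> []" "length us \<le> n" "set us \<subseteq> B" "prod_list us = x"
    using assms(1)[of x] Cons.prems by auto
  have "length us \<ge> 1" using us(1) by (simp add: Suc_leI)
  with zs us show ?case by (intro exI[of _ "us @ zs"]) auto
qed simp

text \<open>Two factorizations of one element over \<open>T\<close> refine to factorizations over
  \<open>S\<close> of a common length, which is at least \<open>length xs\<close> and at most
  \<open>n * length ys\<close>.\<close>

lemma elasticity_le:
  assumes P: "principal_domain (ring_on S)" and T: "cring (ring_on T)"
    and bound: "\<And>a. a \<in> Irr (ring_on T) \<Longrightarrow>
      \<exists>xs. xs \<noteq> [] \<and> length xs \<le> n \<and> set xs \<subseteq> Irr (ring_on S) \<and> prod_list xs = a"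
  shows "elasticity (ring_on T) \<le> ennreal (real n)"
  unfolding elasticity_def
proof (rule Sup_least, safe)
  fix xs ys :: "'a list"
  assume xs: "set xs \<subseteq> Irr (ring_on T)" and ys: "set ys \<subseteq> Irr (ring_on T)" "ys \<noteq> []"
    and eq: "finprod (ring_on T) ((!) xs) {..<length xs} = finprod (ring_on T) ((!) ys) {..<length ys}"
  have fp: "finprod (ring_on T) ((!) zs) {..<length zs} = prod_list zs"
    if "set zs \<subseteq> Irr (ring_on T)" for zs
  proof -
    have "(!) zs ` {..<length zs} \<subseteq> T"
      using that by (auto simp: Irr_ring_on_iff[OF T] dest!: subsetD nth_mem)
    then show ?thesis
      by (simp add: finprod_ring_on[OF T] prod.list_conv_set_nth atLeast0LessThan)
  qed
  obtain us where us: "set us \<subseteq> Irr (ring_on S)" "prod_list us = prod_list xs"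
    "length xs \<le> length us"
    using prod_list_refinement[OF bound xs] by blast
  obtain vs where vs: "set vs \<subseteq> Irr (ring_on S)" "prod_list vs = prod_list ys"
    "length vs \<le> n * length ys"
    using prod_list_refinement[OF bound ys(1)] by blast
  have "length us = length vs"
    using eq us(1,2) vs(1,2) fp[OF xs] fp[OF ys(1)]
    by (intro length_Irr_factorization_unique[OF P]) simp_all
  with us(3) vs(3) have "length xs \<le> n * length ys" by simp
  then have "real (length xs) \<le> real n * real (length ys)"
    by (metis of_nat_le_iff of_nat_mult)
  then have "real (length xs) / real (length ys) \<le> real n"
    using ys(2) by (simp add: divide_le_eq)
  then show "ennreal (real (length xs) / real (length ys)) \<le> ennreal (real n)"
    by (rule ennreal_leI)
qed

theorem theorem2p3:
  fixes K \<O> :: "'a::field_char_0 set"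
  assumes "number_field K"
    and "class_number (ring_on (ring_of_integers K)) = 1"
    and "order_in K \<O>"
    and "\<O> \<subseteq> ring_of_integers K"
    and "primeideal (conductor (ring_on (ring_of_integers K)) \<O>) (ring_on (ring_of_integers K))"
    and "rel_Davenport (ring_on (ring_of_integers K)) \<O> < \<infinity>"
  shows "elasticity (ring_on \<O>) < \<infinity>"
proof -
  let ?S = "ring_of_integers K"
  let ?F = "conductor (ring_on ?S) \<O>"
  have S: "cring (ring_on ?S)" using assms(5) by (simp add: primeideal_def)
  have P: "principal_domain (ring_on ?S)"
    by (rule principal_domain_of_class_number_one[OF S assms(2)])
  have "domain (ring_on (UNIV :: 'a set))"
    by (intro domain_ring_on) (metis cring_from_type_algebra ring_on_UNIV)
  moreover have "subring K (ring_on UNIV)"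
    using assms(1) by (simp add: number_field_def subfieldE(1))
  ultimately have "domain (ring_on K)"
    using domain.subring_is_domain[of "ring_on UNIV" K] by simp
  moreover have "subring \<O> (ring_on K)" using assms(3) by (simp add: order_in_def)
  ultimately have "domain (ring_on \<O>)"
    using domain.subring_is_domain[of "ring_on K" \<O>] by simp
  then have T: "cring (ring_on \<O>)" by (simp add: domain_def)
  have int: "\<And>x. x \<in> ?S \<Longrightarrow> algebraic_int x" by (simp add: ring_of_integers_def)
  \<comment> \<open>A finite infimum in \<open>enat\<close> comes from a nonempty set; any member
    \<open>n\<close> serves as a bound for the elasticity.\<close>
  have "{enat n |n. \<forall>xs. set xs \<subseteq> Irr (ring_on ?S) \<and> length xs = n \<longrightarrow>
      has_subproduct_in (ring_on ?S) \<O> xs} \<noteq> {}" (is "?A \<noteq> {}")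
  proof
    assume "?A = {}"
    then have "rel_Davenport (ring_on ?S) \<O> = Inf {}" by (simp only: rel_Davenport_def)
    with assms(6) show False by (simp add: Inf_enat_def)
  qed
  then obtain n where D: "\<And>xs. set xs \<subseteq> Irr (ring_on ?S) \<Longrightarrow> length xs = n \<Longrightarrow>
      has_subproduct_in (ring_on ?S) \<O> xs" by blast
  \<comment> \<open>Take the multiplier 1 in the definition of the conductor.\<close>
  have "?F \<subseteq> \<O>"
    using cring_ring_on_closed(2)[OF S] by (force simp: conductor_ring_on)
  then have "elasticity (ring_on \<O>) \<le> ennreal (real n)"
    using Irr_subring_factorization[OF P T assms(4) int assms(5) conductor_ne_zero[OF P T int D] _ D]
    by (intro elasticity_le[OF P T])
  also have "\<dots> < \<infinity>" by simp
  finally show ?thesis .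
qed

end
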